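(* For every $q$ with $0\le q\le r$, the map $\psi\circ\delta:\mathcal{T}_q\to\mathcal{T}_q$ yields the normal form with respect to the Gröbner basis $\Delta_q$ of $\mathcal{J}_q$ (for the term order $\prec_q$); that is, for every $v\in\mathcal{T}_q$ the element $\psi(\delta(v))$ is the normal form of $v$ with respect to $\Delta_q$. Moreover, the map $\delta\circ\psi=1-\psi\circ\delta$ on $\mathcal{T}_q$ is a projector on $\mathcal{J}_q$ (i.e. it is idempotent with image $\mathcal{J}_q$).
   Context: Let $\Bbbk$ be a field, $\mathcal{P}=\Bbbk[x_1,\dots,x_n]$, and $\mathcal{M}=\{m_1,\dots,m_r\}\subset\mathcal{P}$ a finite set of $r$ monomials, numbered in a fixed way. An ascending sequence of length $q$ is $\mathbf{k}=(k_1,\dots,k_q)$ with $1\le k_1<\cdots<k_q\le r$; put $m_{\mathbf{k}}=\mathrm{lcm}(m_{k_1},\dots,m_{k_q})$ (and $m_{\emptyset}=1$). Let $\mathbf{k}\setminus k_\ell$ denote $\mathbf{k}$ with the entry $k_\ell$ removed and $(i,\mathbf{k})=(i,k_1,\dots,k_q)$. Let $\mathcal{V}$ be a $\Bbbk$-vector space with basis $v_1,\dots,v_r$, let $\mathcal{T}_q=\mathcal{P}\otimes\Lambda^q\mathcal{V}$, which is a free $\mathcal{P}$-module with basis $v_{\mathbf{k}}=v_{k_1}\wedge\cdots\wedge v_{k_q}$ ($\mathbf{k}$ ascending of length $q$), so $\mathcal{T}_0=\mathcal{P}$. The Taylor differential is, for $q\ge1$, the $\mathcal{P}$-linear map $\delta:\mathcal{T}_q\to\mathcal{T}_{q-1}$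 with $$\delta v_{\mathbf{k}}=\sum_{\ell=1}^q(-1)^{\ell-1}\frac{m_{\mathbf{k}}}{m_{\mathbf{k}\setminus k_\ell}}\,v_{\mathbf{k}\setminus k_\ell}.$$ A term is a monomial times a basis vector; the leading term $\mathrm{lt}$ of an element is its largest term, taken without its coefficient. For sequences of equal length, $\mathbf{k}<\mathbf{l}$ means that $k_j<l_j$ for $j=\min\{i\mid k_i\ne l_i\}$. Let $\prec_0$ be an arbitrary term order on $\mathcal{P}$. For sequences $\mathbf{k},\mathbf{l}$ of length $q+1$ and monomials $s,t$, set $s v_{\mathbf{k}}\prec_{q+1}t v_{\mathbf{l}}$ if either $\mathrm{lt}_{\prec_q}(s\,\delta v_{\mathbf{k}})\prec_q\mathrm{lt}_{\prec_q}(t\,\delta v_{\mathbf{l}})$, or these are equal and $\mathbf{k}<\mathbf{l}$. Put $\Delta_q=\{\delta v_{\mathbf{k}}\mid\mathbf{k}\text{ ascending of length }q+1\}$ and let $\mathcal{J}_q=\delta(\mathcal{T}_{q+1})\subseteq\mathcal{T}_q$ be the submodule it generates; $\Delta_q$ is a Gröbner basis of $\mathcal{J}_q$ for $\prec_q$. The normal form of $v\in\mathcal{T}_q$ with respect to $\Delta_q$ is the unique $\hat v\in\mathcal{T}_q$ with $v-\hat v\in\mathcal{J}_q$ such that no term of $\hat v$ lies in the submodule $\mathrm{lt}_{\prec_q}\mathcal{J}_q$ generated by the leading terms of elements of $\mathcal{J}_q$. Fröberg's contracting homotopy is the $\Bbbk$-linear map $\psi:\mathcal{T}_q\to\mathcal{T}_{q+1}$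 defined on terms as follows: let $\iota=\iota(x^\mu v_{\mathbf{k}})$ be the minimal $i$ such that $m_i\mid x^\mu m_{\mathbf{k}}$; then $$\psi(x^\mu v_{\mathbf{k}})=\frac{x^\mu m_{\mathbf{k}}}{m_{(\iota,\mathbf{k})}}\,v_{(\iota,\mathbf{k})}\ \text{ if }\iota<k_1,\qquad\psi(x^\mu v_{\mathbf{k}})=0\ \text{ otherwise.}$$ For $q=0$ the condition $\iota<k_1$ is regarded as satisfied whenever $\iota$ exists, and $\psi(x^\mu)=0$ if no $m_i$ divides $x^\mu$. In degree $0$ the complex is understood as augmented: $\mathcal{T}_{-1}=\mathcal{P}/\mathcal{J}_0$, $\delta:\mathcal{T}_0\to\mathcal{T}_{-1}$ is the canonical projection, and $\psi:\mathcal{T}_{-1}\to\mathcal{T}_0$ sends a class to its unique representative none of whose terms lies in $\mathcal{J}_0$. Fröberg's theorem is that $\delta\psi+\psi\delta=1$. *)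

theory Defs
  imports Complex_Main "HOL-Library.Poly_Mapping"
begin

section \<open>The polynomial ring and its monomials\<close>

text \<open>
  A monomial \<open>x\<^sup>\<mu>\<close> is represented by its exponent vector \<open>\<mu>\<close>; the variables are the elements of the
  finite type \<open>'x\<close>. Products of monomials are sums of exponent vectors, the monomial \<open>1\<close> is
  the exponent vector \<open>0\<close>, and the quotient \<open>t/s\<close> (only ever formed when \<open>s\<close> divides \<open>t\<close>) is \<open>t - s\<close>.
\<close>

type_synonym 'x monomial = "'x \<Rightarrow>\<^sub>0 nat"
type_synonym ('x, 'k) mpoly = "'x monomial \<Rightarrow>\<^sub>0 'k"

definition mon_dvd :: "'x monomial \<Rightarrow> 'x monomial \<Rightarrow> bool" where
  "mon_dvd s t \<longleftrightarrow> (\<exists>u. t = s + u)"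

lift_definition mon_lcm :: "'x monomial \<Rightarrow> 'x monomial \<Rightarrow> 'x monomial"
  is "\<lambda>s t x. max (s x) (t x)"
  proof -
  fix s t :: "'x \<Rightarrow> nat"
  assume "finite {x. s x \<noteq> 0}" "finite {x. t x \<noteq> 0}"
  then have "finite ({x. s x \<noteq> 0} \<union> {x. t x \<noteq> 0})"
    by simp
  then show "finite {x. max (s x) (t x) \<noteq> 0}"
    by (rule rev_finite_subset) auto
qed

definition is_term_order :: "('x monomial \<Rightarrow> 'x monomial \<Rightarrow> bool) \<Rightarrow> bool" where
  "is_term_order prec \<longleftrightarrow>
     (\<forall>s. \<not> prec s s) \<and>
     (\<forall>s t u. prec s t \<longrightarrow> prec t u \<longrightarrow> prec s u) \<and>
     (\<forall>s t. s \<noteq> t \<longrightarrow> prec s t \<or> prec t s) \<and>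
     (\<forall>t. t \<noteq> 0 \<longrightarrow> prec 0 t) \<and>
     (\<forall>s t u. prec s t \<longrightarrow> prec (u + s) (u + t))"


section \<open>The Taylor complex\<close>

text \<open>
  The basis vector \<open>v\<^sub>k\<close> is identified with the ascending sequence \<open>k\<close>, so that an element of the free
  module is a finitely supported function from sequences to polynomials.
\<close>

type_synonym ('x, 'k) taylor = "nat list \<Rightarrow>\<^sub>0 ('x, 'k) mpoly"

definition ascending :: "nat \<Rightarrow> nat \<Rightarrow> nat list set" where
  "ascending r q = {ks. length ks = q \<and> sorted_wrt (<) ks \<and> set ks \<subseteq> {1..r}}"

definition mseq :: "(nat \<Rightarrow> 'x monomial) \<Rightarrow> nat list \<Rightarrow> 'x monomial" where
  "mseq m ks = foldr (\<lambda>i. mon_lcm (m i)) ks 0"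

definition Tay :: "nat \<Rightarrow> nat \<Rightarrow> ('x, 'k::zero) taylor set" where
  "Tay r q = {v. Poly_Mapping.keys v \<subseteq> ascending r q}"

definition scale :: "('x, 'k::comm_ring_1) mpoly \<Rightarrow> ('x, 'k) taylor \<Rightarrow> ('x, 'k) taylor" where
  "scale p v = Poly_Mapping.map (\<lambda>c. p * c) v"

lemma lookup_scale: "Poly_Mapping.lookup (scale p v) ks = p * Poly_Mapping.lookup v ks"
  unfolding scale_def by transfer (auto simp: when_def)

global_interpretation taylor: module scale
  by standard
    (auto intro!: poly_mapping_eqI simp: lookup_scale Poly_Mapping.lookup_add algebra_simps)

definition term_vec :: "'x monomial \<times> nat list \<Rightarrow> ('x, 'k::zero_neq_one) taylor" where
  "term_vec a = Poly_Mapping.single (snd a) (Poly_Mapping.single (fst a) 1)"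

definition basis_vec :: "nat list \<Rightarrow> ('x, 'k::zero_neq_one) taylor" where
  "basis_vec ks = term_vec (0, ks)"

definition remove_at :: "nat \<Rightarrow> 'a list \<Rightarrow> 'a list" where
  "remove_at l ks = take l ks @ drop (Suc l) ks"

text \<open>List positions are counted from \<open>0\<close>, hence the sign is \<open>(-1)\<^sup>l\<close>.\<close>

definition delta_basis :: "(nat \<Rightarrow> 'x monomial) \<Rightarrow> nat list \<Rightarrow> ('x, 'k::comm_ring_1) taylor" where
  "delta_basis m ks =
     (\<Sum>l<length ks. scale (Poly_Mapping.single (mseq m ks - mseq m (remove_at l ks)) ((-1) ^ l))
                       (basis_vec (remove_at l ks)))"

text \<open>The differential in all degrees \<open>q \<ge> 1\<close>; degree \<open>0\<close> is treated separately below.\<close>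

definition delta :: "(nat \<Rightarrow> 'x monomial) \<Rightarrow> ('x, 'k::comm_ring_1) taylor \<Rightarrow> ('x, 'k) taylor" where
  "delta m v = (\<Sum>ks\<in>Poly_Mapping.keys v. scale (Poly_Mapping.lookup v ks) (delta_basis m ks))"

definition Delta :: "nat \<Rightarrow> (nat \<Rightarrow> 'x monomial) \<Rightarrow> nat \<Rightarrow> ('x, 'k::comm_ring_1) taylor set" where
  "Delta r m q = delta_basis m ` ascending r (q + 1)"

definition J :: "nat \<Rightarrow> (nat \<Rightarrow> 'x monomial) \<Rightarrow> nat \<Rightarrow> ('x, 'k::comm_ring_1) taylor set" where
  "J r m q = delta m ` Tay r (q + 1)"


section \<open>Term orders and normal forms\<close>

definition terms :: "('x, 'k::zero) taylor \<Rightarrow> ('x monomial \<times> nat list) set" where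
  "terms v = {(s, ks). Poly_Mapping.lookup (Poly_Mapping.lookup v ks) s \<noteq> 0}"

definition lead_term :: "('x monomial \<times> nat list \<Rightarrow> 'x monomial \<times> nat list \<Rightarrow> bool) \<Rightarrow>
    ('x, 'k::zero) taylor \<Rightarrow> 'x monomial \<times> nat list" where
  "lead_term prec v = (THE a. a \<in> terms v \<and> (\<forall>b\<in>terms v. b \<noteq> a \<longrightarrow> prec b a))"

text \<open>
  \<open>lex less_than\<close> compares sequences of equal length at the first position where they differ.
  The additional argument of type \<open>'k itself\<close> only fixes the coefficients of the vectors
  \<open>s \<delta> v\<^sub>k\<close> whose leading terms are compared.
\<close>

primrec tless :: "'k::comm_ring_1 itself \<Rightarrow> (nat \<Rightarrow> 'x monomial) \<Rightarrow>
    ('x monomial \<Rightarrow> 'x monomial \<Rightarrow> bool) \<Rightarrow> nat \<Rightarrow>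
    'x monomial \<times> nat list \<Rightarrow> 'x monomial \<times> nat list \<Rightarrow> bool" where
  "tless K m prec0 0 = (\<lambda>a b. prec0 (fst a) (fst b))"
| "tless K m prec0 (Suc q) = (\<lambda>(s, ks) (t, ls).
     let lt = (\<lambda>s ks. lead_term (tless K m prec0 q)
                  (scale (Poly_Mapping.single s 1) (delta_basis m ks :: ('x, 'k) taylor)))
     in tless K m prec0 q (lt s ks) (lt t ls) \<or> lt s ks = lt t ls \<and> (ks, ls) \<in> lex less_than)"

definition lt_module :: "('x monomial \<times> nat list \<Rightarrow> 'x monomial \<times> nat list \<Rightarrow> bool) \<Rightarrow>
    ('x, 'k::comm_ring_1) taylor set \<Rightarrow> ('x, 'k) taylor set" where
  "lt_module prec N = taylor.span ((\<lambda>u. term_vec (lead_term prec u)) ` (N - {0}))"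

text \<open>
  Normal forms with respect to a set \<open>G\<close> of generators of a submodule of \<open>T\<close>; uniqueness is part of
  the notion.
\<close>

definition reduced_rep :: "('x monomial \<times> nat list \<Rightarrow> 'x monomial \<times> nat list \<Rightarrow> bool) \<Rightarrow>
    ('x, 'k::comm_ring_1) taylor set \<Rightarrow> ('x, 'k) taylor set \<Rightarrow>
    ('x, 'k) taylor \<Rightarrow> ('x, 'k) taylor \<Rightarrow> bool" where
  "reduced_rep prec T G v w \<longleftrightarrow>
     w \<in> T \<and> v - w \<in> taylor.span G \<and>
     (\<forall>a\<in>terms w. term_vec a \<notin> lt_module prec (taylor.span G))"

definition is_normal_form :: "('x monomial \<times> nat list \<Rightarrow> 'x monomial \<times> nat list \<Rightarrow> bool) \<Rightarrow>
    ('x, 'k::comm_ring_1) taylor set \<Rightarrow> ('x, 'k) taylor set \<Rightarrow>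
    ('x, 'k) taylor \<Rightarrow> ('x, 'k) taylor \<Rightarrow> bool" where
  "is_normal_form prec T G v w \<longleftrightarrow>
     reduced_rep prec T G v w \<and> (\<forall>w'. reduced_rep prec T G v w' \<longrightarrow> w' = w)"


section \<open>The contracting homotopy\<close>

definition psi_term :: "nat \<Rightarrow> (nat \<Rightarrow> 'x monomial) \<Rightarrow> 'x monomial \<times> nat list \<Rightarrow>
    ('x, 'k::zero_neq_one) taylor" where
  "psi_term r m = (\<lambda>(s, ks).
     let divs = {i \<in> {1..r}. mon_dvd (m i) (s + mseq m ks)};
         \<iota> = Min divs
     in if divs \<noteq> {} \<and> (ks = [] \<or> \<iota> < hd ks)
        then term_vec (s + mseq m ks - mseq m (\<iota> # ks), \<iota> # ks)
        else 0)"

text \<open>The constant polynomial \<open>c\<close> is \<open>Poly_Mapping.single 0 c\<close>.\<close>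

definition psi :: "nat \<Rightarrow> (nat \<Rightarrow> 'x monomial) \<Rightarrow> ('x, 'k::comm_ring_1) taylor \<Rightarrow> ('x, 'k) taylor" where
  "psi r m v = (\<Sum>(s, ks)\<in>terms v.
     scale (Poly_Mapping.single 0 (Poly_Mapping.lookup (Poly_Mapping.lookup v ks) s))
       (psi_term r m (s, ks)))"

text \<open>
  The augmentation: the elements of \<open>P/J\<^sub>0\<close> are the cosets of \<open>J\<^sub>0\<close>.
\<close>

definition aug_delta :: "nat \<Rightarrow> (nat \<Rightarrow> 'x monomial) \<Rightarrow> ('x, 'k::comm_ring_1) taylor \<Rightarrow>
    ('x, 'k) taylor set" where
  "aug_delta r m v = {w \<in> Tay r 0. v - w \<in> J r m 0}"

definition aug_psi :: "nat \<Rightarrow> (nat \<Rightarrow> 'x monomial) \<Rightarrow> ('x, 'k::comm_ring_1) taylor set \<Rightarrow>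
    ('x, 'k) taylor" where
  "aug_psi r m C = (THE w. w \<in> C \<and> (\<forall>a\<in>terms w. term_vec a \<notin> (J r m 0 :: ('x, 'k) taylor set)))"

definition psi_delta :: "nat \<Rightarrow> (nat \<Rightarrow> 'x monomial) \<Rightarrow> nat \<Rightarrow> ('x, 'k::comm_ring_1) taylor \<Rightarrow>
    ('x, 'k) taylor" where
  "psi_delta r m q v = (if q = 0 then aug_psi r m (aug_delta r m v) else psi r m (delta m v))"

definition delta_psi :: "nat \<Rightarrow> (nat \<Rightarrow> 'x monomial) \<Rightarrow> ('x, 'k::comm_ring_1) taylor \<Rightarrow>
    ('x, 'k) taylor" where
  "delta_psi r m v = delta m (psi r m v)"


section \<open>The boundary module is generated by the boundaries of the basis vectors\<close>

lemma module_hom_delta: "module_hom scale scale (delta m :: ('x, 'k::comm_ring_1) taylor \<Rightarrow> _)"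
proof -
  have delta_superset: "delta m v = (\<Sum>ks\<in>A. scale (Poly_Mapping.lookup v ks) (delta_basis m ks))"
    if "finite A" "Poly_Mapping.keys v \<subseteq> A" for A and v :: "('x, 'k) taylor"
    unfolding delta_def using that
    by (intro sum.mono_neutral_left) (auto simp: in_keys_iff)
  show ?thesis
    unfolding module_hom_iff
  proof (intro conjI allI taylor.module_axioms)
    fix v w :: "('x, 'k) taylor" and p
    let ?A = "Poly_Mapping.keys v \<union> Poly_Mapping.keys w"
    have "delta m (v + w) = (\<Sum>ks\<in>?A. scale (Poly_Mapping.lookup (v + w) ks) (delta_basis m ks))"
      by (rule delta_superset) (auto simp: in_keys_iff Poly_Mapping.lookup_add)
    also have "\<dots> = delta m v + delta m w"
      by (simp add: delta_superset[of ?A v] delta_superset[of ?A w] Poly_Mapping.lookup_add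
          taylor.scale_left_distrib sum.distrib)
    finally show "delta m (v + w) = delta m v + delta m w" .
    have "delta m (scale p v) =
        (\<Sum>ks\<in>Poly_Mapping.keys v. scale (Poly_Mapping.lookup (scale p v) ks) (delta_basis m ks))"
      by (rule delta_superset) (auto simp: in_keys_iff lookup_scale)
    also have "\<dots> = scale p (delta m v)"
      by (simp add: delta_def lookup_scale taylor.scale_sum_right)
    finally show "delta m (scale p v) = scale p (delta m v)" .
  qed
qed

lemma delta_basis_vec: "delta m (basis_vec ks) = delta_basis m ks"
  by (simp add: delta_def basis_vec_def term_vec_def single_one)

lemma span_basis_vec: "taylor.span (basis_vec ` ascending r q) = (Tay r q :: ('x, 'k::comm_ring_1) taylor set)"
proof
  have "taylor.subspace (Tay r q :: ('x, 'k) taylor set)"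
    by (auto simp: taylor.subspace_def Tay_def in_keys_iff lookup_scale Poly_Mapping.lookup_add
        subset_iff)
      (metis add.right_neutral, metis mult_zero_right)
  then show "taylor.span (basis_vec ` ascending r q) \<subseteq> (Tay r q :: ('x, 'k) taylor set)"
    by (rule taylor.span_minimal[rotated]) (auto simp: Tay_def basis_vec_def term_vec_def)
next
  show "(Tay r q :: ('x, 'k) taylor set) \<subseteq> taylor.span (basis_vec ` ascending r q)"
  proof
    fix v :: "('x, 'k) taylor" assume v: "v \<in> Tay r q"
    have "v = (\<Sum>ks\<in>Poly_Mapping.keys v. scale (Poly_Mapping.lookup v ks) (basis_vec ks))"
      by (rule poly_mapping_eqI)
        (auto simp: Poly_Mapping.lookup_sum lookup_scale basis_vec_def term_vec_def single_one
          Poly_Mapping.lookup_single when_def if_distrib in_keys_iff sum.If_cases cong: if_cong)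
    also have "\<dots> \<in> taylor.span (basis_vec ` ascending r q)"
      using v by (intro taylor.span_sum taylor.span_scale taylor.span_base) (auto simp: Tay_def)
    finally show "v \<in> taylor.span (basis_vec ` ascending r q)" .
  qed
qed

lemma span_Delta: "taylor.span (Delta r m q) = (J r m q :: ('x, 'k::comm_ring_1) taylor set)"
proof -
  interpret d: module_hom scale scale "delta m :: ('x, 'k) taylor \<Rightarrow> _"
    by (rule module_hom_delta)
  have "Delta r m q = delta m ` (basis_vec ` ascending r (q + 1) :: ('x, 'k) taylor set)"
    unfolding Delta_def image_image delta_basis_vec ..
  then show ?thesis
    using d.span_image[of "basis_vec ` ascending r (q + 1)"] by (simp add: span_basis_vec J_def)
qed

end

theory Submission
  imports Defs
begin

text \<open>
  Attach to a term \<open>x\<^sup>\<mu> v\<^sub>k\<close> its multidegree \<open>M = x\<^sup>\<mu> m\<^sub>k\<close>. Both \<open>\<delta>\<close> and \<open>\<psi>\<close> preserve \<open>M\<close>, and a term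
  is determined by \<open>M\<close> and \<open>k\<close>, where the entries of \<open>k\<close> are indices of divisors of \<open>M\<close>. So in multidegree
  \<open>M\<close> the Taylor complex is the simplicial chain complex of the full simplex on the set
  \<open>{i. m\<^sub>i dvd M}\<close>, all the coefficients \<open>m\<^sub>k/m\<^sub>l\<close> having disappeared, and \<open>\<psi>\<close> is the cone construction
  with the smallest vertex \<open>\<iota>\<close> as apex. The identity \<open>\<delta>\<psi> + \<psi>\<delta> = 1\<close> in positive degrees and
  \<open>\<delta>\<delta> = 0\<close> (lemmas \<open>homotopy\<close>, \<open>delta_delta\<close>) both follow from the recursion
  \<open>\<delta>(i, k) = k - (i, \<delta> k)\<close>. Applying \<open>\<delta>\<close> to the homotopy identity gives \<open>\<delta>\<psi>\<delta> = \<delta>\<close>, that is,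
  \<open>\<delta>\<psi>\<close> fixes \<open>J\<^sub>q\<close> pointwise (\<open>delta_psi_J\<close>). Its image lies in \<open>J\<^sub>q\<close>, so it is a projector
  on \<open>J\<^sub>q\<close>.

  The order \<open>\<prec>\<^sub>q\<close>, defined by recursion through leading terms, has a closed form: compare the
  multidegrees by \<open>\<prec>\<^sub>0\<close> and break ties by comparing the sequences at the last position where they
  differ (\<open>tless_iff_homog_less\<close>). The leading term of \<open>\<delta>(i, k)\<close> is therefore the one at \<open>k\<close>, the face
  opposite to the smallest vertex. Call a term \<open>x\<^sup>\<mu> v\<^sub>k\<close> reducible if some \<open>m\<^sub>i\<close> with \<open>i < k\<^sub>1\<close>
  divides its multidegree (any \<open>i\<close>, when \<open>k\<close> is empty). This is exactly the condition under which
  \<open>\<psi>\<close> does not kill the term, and then \<open>\<delta>\<psi>\<close> sends it to itself plus smaller terms. Hence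
  \<open>1 - \<delta>\<psi>\<close> fixes irreducible terms and strictly lowers reducible ones. As it vanishes on \<open>J\<^sub>q\<close>, the
  leading term of an element of \<open>J\<^sub>q\<close> cannot be irreducible; so the terms in the leading module
  of \<open>J\<^sub>q\<close> are the reducible ones (\<open>term_vec_in_lt_module_iff\<close>).

  Finally \<open>v - \<delta>\<psi> v\<close> has only irreducible terms: for \<open>q > 0\<close> it is \<open>\<psi>(\<delta> v)\<close>, whose terms have the
  apex as first entry, and for \<open>q = 0\<close> the map \<open>\<delta>\<psi>\<close> is the projection on the reducible terms. It is
  the only such element of \<open>v + J\<^sub>q\<close>, because an element of \<open>J\<^sub>q\<close> with irreducible terms is killed by
  \<open>\<psi>\<close> and fixed by \<open>\<delta>\<psi>\<close>, hence \<open>0\<close> (\<open>irreducible_representative_iff\<close>). In degree \<open>0\<close> the same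
  uniqueness identifies the augmented composition with \<open>1 - \<delta>\<psi>\<close> (\<open>psi_delta_eq\<close>).
\<close>

section \<open>Monomials\<close>

lemma mon_dvd_iff_lookup_le:
  "mon_dvd s t \<longleftrightarrow> (\<forall>x. Poly_Mapping.lookup s x \<le> Poly_Mapping.lookup t x)"
proof
  assume "\<forall>x. Poly_Mapping.lookup s x \<le> Poly_Mapping.lookup t x"
  then have "t = s + (t - s)"
    by (intro poly_mapping_eqI) (simp add: Poly_Mapping.lookup_add Poly_Mapping.lookup_minus)
  then show "mon_dvd s t"
    unfolding mon_dvd_def ..
qed (auto simp: mon_dvd_def Poly_Mapping.lookup_add)

lemma mon_dvd_diff_add: "mon_dvd s t \<Longrightarrow> t - s + s = t"
  by (auto simp: mon_dvd_def add.commute)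

lemma mon_dvd_add_left: "mon_dvd s t \<Longrightarrow> mon_dvd s (u + t)"
  by (auto simp: mon_dvd_iff_lookup_le Poly_Mapping.lookup_add trans_le_add2)

lemma mon_dvd_add_diff: "mon_dvd s t \<Longrightarrow> u + (t - s) = u + t - s"
  by (auto simp: mon_dvd_def poly_mapping_eq_iff fun_eq_iff Poly_Mapping.lookup_add
      Poly_Mapping.lookup_minus)

lemma mseq_mon_dvd_iff: "mon_dvd (mseq m ks) M \<longleftrightarrow> (\<forall>i\<in>set ks. mon_dvd (m i) M)"
  by (induction ks) (auto simp: mseq_def mon_dvd_iff_lookup_le mon_lcm.rep_eq)

lemma mseq_mon_dvd_mono:
  "set ks \<subseteq> set ls \<Longrightarrow> mon_dvd (mseq m ls) M \<Longrightarrow> mon_dvd (mseq m ks) M"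
  by (auto simp: mseq_mon_dvd_iff)

lemma mseq_mon_dvd_add [simp]: "mon_dvd (mseq m ks) (s + mseq m ks)"
  by (auto simp: mon_dvd_iff_lookup_le Poly_Mapping.lookup_add)

section \<open>Coefficients and scalar-linear maps\<close>

definition coef :: "('x, 'k::zero) taylor \<Rightarrow> 'x monomial \<times> nat list \<Rightarrow> 'k" where
  "coef v a = Poly_Mapping.lookup (Poly_Mapping.lookup v (snd a)) (fst a)"

text \<open>
  The map \<open>\<psi>\<close> is linear over the coefficient ring but not over the polynomial ring, so the complex is
  also needed as a module over the coefficients.
\<close>

definition cscale :: "'k::comm_ring_1 \<Rightarrow> ('x, 'k) taylor \<Rightarrow> ('x, 'k) taylor" where
  "cscale c = scale (Poly_Mapping.single 0 c)"

lemma mem_terms_iff: "a \<in> terms v \<longleftrightarrow> coef v a \<noteq> 0"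
  by (cases a) (simp add: terms_def coef_def)

lemma coef_eqI: "(\<And>a. coef v a = coef w a) \<Longrightarrow> v = w"
  by (intro poly_mapping_eqI) (force simp: coef_def)

lemma coef_zero [simp]: "coef 0 a = 0"
  by (simp add: coef_def)

lemma coef_add: "coef (v + w) a = coef v a + coef w a"
  by (simp add: coef_def Poly_Mapping.lookup_add)

lemma coef_diff: "coef (v - w) a = coef v a - coef w a"
  for v :: "('x, 'k::comm_ring_1) taylor"
  by (simp add: coef_def Poly_Mapping.lookup_minus)

lemma coef_sum: "coef (sum f A) a = (\<Sum>x\<in>A. coef (f x) a)"
  for f :: "'b \<Rightarrow> ('x, 'k::comm_ring_1) taylor"
  by (induction A rule: infinite_finite_induct) (auto simp: coef_add)

lemma coef_cscale: "coef (cscale c v) a = c * coef v a"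
  by (simp add: coef_def cscale_def lookup_scale Poly_Mapping.map.rep_eq when_def
      flip: mult_map_scale_conv_mult)

lemma coef_term_vec: "coef (term_vec a) b = (if a = b then 1 else 0)"
  by (cases a; cases b) (auto simp: coef_def term_vec_def Poly_Mapping.lookup_single when_def)

lemma finite_terms: "finite (terms v)"
proof -
  have "terms v \<subseteq>
      (\<lambda>(ks, s). (s, ks)) ` (SIGMA ks:Poly_Mapping.keys v. Poly_Mapping.keys (Poly_Mapping.lookup v ks))"
    by (force simp: terms_def in_keys_iff)
  then show ?thesis
    by (rule finite_subset) auto
qed

lemma terms_empty_iff: "terms v = {} \<longleftrightarrow> v = 0"
proof
  assume "terms v = {}"
  then show "v = 0"
    by (intro coef_eqI) (metis coef_zero empty_iff mem_terms_iff)
qed (simp add: terms_def)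

lemma terms_zero [simp]: "terms 0 = {}"
  by (simp add: terms_empty_iff)

lemma terms_term_vec: "terms (term_vec a :: ('x, 'k::comm_ring_1) taylor) = {a}"
  by (auto simp: mem_terms_iff coef_term_vec split: if_splits)

lemma terms_diff: "terms (v - w) \<subseteq> terms v \<union> terms w"
  for v :: "('x, 'k::comm_ring_1) taylor"
  by (auto simp: mem_terms_iff coef_diff)

lemma Tay_iff_terms: "v \<in> Tay r q \<longleftrightarrow> snd ` terms v \<subseteq> ascending r q"
proof -
  have "Poly_Mapping.keys v = snd ` terms v"
  proof (intro set_eqI)
    fix ks
    have "ks \<in> Poly_Mapping.keys v \<longleftrightarrow> (\<exists>s. Poly_Mapping.lookup (Poly_Mapping.lookup v ks) s \<noteq> 0)"
      unfolding in_keys_iff by (metis lookup_zero poly_mapping_eqI)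
    then show "ks \<in> Poly_Mapping.keys v \<longleftrightarrow> ks \<in> snd ` terms v"
      by (auto simp: terms_def image_iff)
  qed
  then show ?thesis
    by (simp add: Tay_def)
qed

global_interpretation cmod: module cscale
  by standard (simp_all add: cscale_def taylor.scale_right_distrib taylor.scale_left_distrib
      single_add mult_single)

global_interpretation cmod_pair: module_pair cscale cscale ..

lemma terms_expansion: "v = (\<Sum>a\<in>terms v. cscale (coef v a) (term_vec a))"
  for v :: "('x, 'k::comm_ring_1) taylor"
  by (rule coef_eqI)
    (auto simp: coef_sum coef_cscale coef_term_vec if_distrib sum.If_cases finite_terms mem_terms_iff
      cong: if_cong)

abbreviation klinear :: "(('x, 'k::comm_ring_1) taylor \<Rightarrow> ('x, 'k) taylor) \<Rightarrow> bool" where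
  "klinear \<equiv> module_hom cscale cscale"

lemma klinear_expansion:
  assumes "klinear L"
  shows "L v = (\<Sum>a\<in>terms v. cscale (coef v a) (L (term_vec a)))"
proof -
  interpret module_hom cscale cscale L by (rule assms)
  show ?thesis
    by (subst terms_expansion[of v]) (simp add: sum scale)
qed

lemma klinear_eqI:
  assumes "klinear L" "klinear L'" "\<And>a. a \<in> terms v \<Longrightarrow> L (term_vec a) = L' (term_vec a)"
  shows "L v = L' v"
  using assms by (simp add: klinear_expansion[of L v] klinear_expansion[of L' v])

lemma klinear_terms:
  assumes "klinear L"
  shows "terms (L v) \<subseteq> (\<Union>a\<in>terms v. terms (L (term_vec a)))"
proof
  fix b assume "b \<in> terms (L v)"
  then have "(\<Sum>a\<in>terms v. coef v a * coef (L (term_vec a)) b) \<noteq> 0"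
    by (simp add: klinear_expansion[OF assms, of v] mem_terms_iff coef_sum coef_cscale)
  then obtain a where "a \<in> terms v" "coef v a * coef (L (term_vec a)) b \<noteq> 0"
    by (rule sum.not_neutral_contains_not_neutral)
  then show "b \<in> (\<Union>a\<in>terms v. terms (L (term_vec a)))"
    by (auto simp: mem_terms_iff intro!: bexI[of _ a])
qed

lemma klinear_delta: "klinear (delta m :: ('x, 'k::comm_ring_1) taylor \<Rightarrow> _)"
proof -
  interpret module_hom scale scale "delta m :: ('x, 'k::comm_ring_1) taylor \<Rightarrow> _"
    by (rule module_hom_delta)
  show "klinear (delta m :: ('x, 'k) taylor \<Rightarrow> _)"
    by unfold_locales (simp_all add: add scale cscale_def)
qed

lemma klinear_psi: "klinear (psi r m :: ('x, 'k::comm_ring_1) taylor \<Rightarrow> _)"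
proof -
  have psi_eq: "psi r m v = (\<Sum>a\<in>A. cscale (coef v a) (psi_term r m a))"
    if "finite A" "terms v \<subseteq> A" for A and v :: "('x, 'k) taylor"
    unfolding psi_def using that
    by (intro sum.mono_neutral_cong_left)
      (auto simp: mem_terms_iff cscale_def coef_def subset_iff)
  show "klinear (psi r m :: ('x, 'k) taylor \<Rightarrow> _)"
  proof unfold_locales
    fix v w :: "('x, 'k) taylor" and c
    let ?A = "terms v \<union> terms w"
    have "terms (v + w) \<subseteq> ?A"
      by (auto simp: mem_terms_iff coef_add)
    then show "psi r m (v + w) = psi r m v + psi r m w"
      by (simp add: psi_eq[of ?A] finite_terms coef_add cmod.scale_left_distrib sum.distrib)
    have "terms (cscale c v) \<subseteq> terms v"
      by (auto simp: mem_terms_iff coef_cscale)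
    then show "psi r m (cscale c v) = cscale c (psi r m v)"
      by (simp add: psi_eq[of "terms v"] finite_terms coef_cscale cmod.scale_sum_right)
  qed
qed

lemma psi_term_vec: "psi r m (term_vec a) = psi_term r m a"
  by (cases a) (simp add: psi_def terms_term_vec, simp add: term_vec_def)


section \<open>Faces of sequences\<close>

text \<open>
  The alternating sum of \<open>f\<close> over the sequences obtained by deleting one entry. The recursion
  \<open>\<partial>(i, k) = k - (i, \<partial> k)\<close> replaces the usual bookkeeping of signs and positions; the explicit sum is
  recovered in \<open>face_sum_eq_sum\<close>.
\<close>

primrec face_sum :: "(nat list \<Rightarrow> 'v::ab_group_add) \<Rightarrow> nat list \<Rightarrow> 'v" where
  "face_sum f [] = 0"
| "face_sum f (i # ks) = f ks - face_sum (\<lambda>ls. f (i # ls)) ks"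

lemma remove_at_0 [simp]: "remove_at 0 (i # ks) = ks"
  and remove_at_Suc [simp]: "remove_at (Suc l) (i # ks) = i # remove_at l ks"
  by (simp_all add: remove_at_def)

lemma length_remove_at: "l < length ks \<Longrightarrow> length (remove_at l ks) = length ks - 1"
  by (simp add: remove_at_def)

lemma set_remove_at: "set (remove_at l ks) \<subseteq> set ks"
  by (auto simp: remove_at_def dest: in_set_takeD in_set_dropD)

lemma sorted_remove_at: "sorted_wrt (<) ks \<Longrightarrow> sorted_wrt (<) (remove_at l ks)"
  for ks :: "nat list"
proof (induction ks arbitrary: l)
  case (Cons k ks)
  then show ?case
    using set_remove_at[of _ ks] by (cases l) auto
qed (simp add: remove_at_def)

lemma ascending_remove_at:
  "ks \<in> ascending r (Suc q) \<Longrightarrow> l < Suc q \<Longrightarrow> remove_at l ks \<in> ascending r q"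
  using set_remove_at[of l ks] by (auto simp: ascending_def length_remove_at sorted_remove_at)

lemma ascending_Cons_iff:
  "i # ks \<in> ascending r (Suc q) \<longleftrightarrow>
     i \<in> {1..r} \<and> ks \<in> ascending r q \<and> (\<forall>j\<in>set ks. i < j)"
  by (auto simp: ascending_def)

lemma ascending_Cons_hd:
  assumes "ks \<in> ascending r q" "i \<in> {1..r}" "ks = [] \<or> i < hd ks"
  shows "i # ks \<in> ascending r (Suc q)"
  using assms by (cases ks) (auto simp: ascending_def)

lemma face_sum_cong:
  "(\<And>l. l < length ks \<Longrightarrow> f (remove_at l ks) = g (remove_at l ks)) \<Longrightarrow> face_sum f ks = face_sum g ks"
proof (induction ks arbitrary: f g)
  case (Cons i ks)
  have "f ks = g ks"
    using Cons.prems[of 0] by simp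
  moreover have "face_sum (\<lambda>ls. f (i # ls)) ks = face_sum (\<lambda>ls. g (i # ls)) ks"
    using Cons.prems[of "Suc _"] by (intro Cons.IH) simp
  ultimately show ?case
    by simp
qed simp

lemma face_sum_diff: "face_sum (\<lambda>ls. f ls - g ls) ks = face_sum f ks - face_sum g ks"
  by (induction ks arbitrary: f g) simp_all

lemma face_sum_zero: "face_sum (\<lambda>_. 0) ks = 0"
  by (induction ks) simp_all

text \<open>
  The usual cancellation of double deletions is one step of the recursion:
  \<open>\<partial>\<partial>(i, k) = \<partial>k - (\<partial>k - (i, \<partial>\<partial>k))\<close>, where the last summand vanishes by induction.
\<close>

lemma face_sum_face_sum: "face_sum (face_sum f) ks = 0"
  by (induction ks arbitrary: f) (simp_all add: face_sum_diff)

lemma klinear_face_sum: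
  assumes "klinear L"
  shows "L (face_sum f ks) = face_sum (\<lambda>ls. L (f ls)) ks"
proof -
  interpret module_hom cscale cscale L by (rule assms)
  show ?thesis
    by (induction ks arbitrary: f) (simp_all add: diff)
qed

lemma face_sum_eq_sum:
  "face_sum f ks = (\<Sum>l<length ks. cscale ((- 1) ^ l) (f (remove_at l ks)))"
  by (induction ks arbitrary: f)
    (simp_all add: sum.lessThan_Suc_shift sum_negf cmod.scale_minus_left del: sum.lessThan_Suc)

lemma terms_face_sum: "terms (face_sum f ks) \<subseteq> (\<Union>l<length ks. terms (f (remove_at l ks)))"
  for f :: "nat list \<Rightarrow> ('x, 'k::comm_ring_1) taylor"
proof (induction ks arbitrary: f)
  case (Cons i ks)
  show ?case
    using terms_diff[of "f ks" "face_sum (\<lambda>ls. f (i # ls)) ks"] Cons.IH[of "\<lambda>ls. f (i # ls)"]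
    by (auto simp: lessThan_Suc_eq_insert_0)
qed simp

section \<open>The homogeneous parts of the Taylor complex\<close>

text \<open>
  The term of multidegree \<open>M\<close> at the sequence \<open>ks\<close>; meaningful when every \<open>m\<^sub>i\<close> with \<open>i\<close> in \<open>ks\<close>
  divides \<open>M\<close>.
\<close>

definition hterm :: "(nat \<Rightarrow> 'x monomial) \<Rightarrow> 'x monomial \<Rightarrow> nat list \<Rightarrow> ('x, 'k::comm_ring_1) taylor" where
  "hterm m M ks = term_vec (M - mseq m ks, ks)"

lemma term_vec_eq_hterm: "term_vec (s, ks) = hterm m (s + mseq m ks) ks"
  by (simp add: hterm_def)

lemma delta_term_vec:
  "delta m (term_vec (s, ks)) =
    (scale (Poly_Mapping.single s 1) (delta_basis m ks) :: ('x, 'k::comm_ring_1) taylor)"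
proof -
  interpret module_hom scale scale "delta m :: ('x, 'k::comm_ring_1) taylor \<Rightarrow> _"
    by (rule module_hom_delta)
  have "(term_vec (s, ks) :: ('x, 'k) taylor) = scale (Poly_Mapping.single s 1) (basis_vec ks)"
    by (intro poly_mapping_eqI)
      (simp add: lookup_scale basis_vec_def term_vec_def Poly_Mapping.lookup_single when_def
        single_one)
  then show ?thesis
    by (simp add: scale delta_basis_vec)
qed

text \<open>
  In a fixed multidegree the coefficients \<open>m\<^sub>k/m\<^sub>l\<close> are absorbed into the terms, and the Taylor
  differential becomes the boundary of a simplex.
\<close>

lemma delta_hterm:
  assumes "mon_dvd (mseq m ks) M"
  shows "delta m (hterm m M ks) = (face_sum (hterm m M) ks :: ('x, 'k::comm_ring_1) taylor)"
proof -
  have "scale (Poly_Mapping.single (M - mseq m ks) 1)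
          (scale (Poly_Mapping.single (mseq m ks - mseq m ls) c) (basis_vec ls))
        = cscale c (hterm m M ls :: ('x, 'k) taylor)"
    if "set ls \<subseteq> set ks" for ls c
  proof -
    have "mon_dvd (mseq m ls) (mseq m ks)"
      using that mseq_mon_dvd_mono mseq_mon_dvd_add[of m ks 0] by (metis add.left_neutral)
    then have "(M - mseq m ks) + (mseq m ks - mseq m ls) = M - mseq m ls"
      using assms by (simp add: mon_dvd_add_diff mon_dvd_diff_add)
    then show ?thesis
      by (intro poly_mapping_eqI)
        (auto simp: cscale_def hterm_def lookup_scale basis_vec_def term_vec_def mult_single
          Poly_Mapping.lookup_single when_def simp flip: single_one)
  qed
  then show ?thesis
    by (simp add: hterm_def delta_term_vec delta_basis_def face_sum_eq_sum taylor.scale_sum_right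
        set_remove_at del: taylor.scale_scale)
qed

definition cone_apex :: "nat \<Rightarrow> (nat \<Rightarrow> 'x monomial) \<Rightarrow> 'x monomial \<Rightarrow> nat \<Rightarrow> bool" where
  "cone_apex r m M i \<longleftrightarrow>
     i \<in> {1..r} \<and> mon_dvd (m i) M \<and> (\<forall>j\<in>{1..r}. mon_dvd (m j) M \<longrightarrow> i \<le> j)"

lemma cone_apex_exists:
  assumes "i \<in> {1..r}" "mon_dvd (m i) M"
  obtains j where "cone_apex r m M j" "j \<le> i"
proof
  let ?D = "{j \<in> {1..r}. mon_dvd (m j) M}"
  have "i \<in> ?D"
    using assms by simp
  then have "Min ?D \<in> ?D"
    by (intro Min_in) auto
  with \<open>i \<in> ?D\<close> show "cone_apex r m M (Min ?D)" "Min ?D \<le> i"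
    unfolding cone_apex_def by auto
qed

lemma psi_hterm:
  assumes "mon_dvd (mseq m ks) M" "cone_apex r m M i"
  shows "psi r m (hterm m M ks) =
    (if ks = [] \<or> i < hd ks then hterm m M (i # ks) else (0 :: ('x, 'k::comm_ring_1) taylor))"
proof -
  have "Min {j \<in> {1..r}. mon_dvd (m j) M} = i"
    using assms(2) by (intro Min_eqI) (auto simp: cone_apex_def)
  moreover have "{j \<in> {1..r}. mon_dvd (m j) M} \<noteq> {}"
    using assms(2) by (auto simp: cone_apex_def)
  ultimately show ?thesis
    using assms(1) by (simp add: psi_term_vec psi_term_def hterm_def mon_dvd_diff_add)
qed

lemma psi_hterm_no_apex:
  assumes "mon_dvd (mseq m ks) M" "\<nexists>i. cone_apex r m M i"
  shows "psi r m (hterm m M ks) = (0 :: ('x, 'k::comm_ring_1) taylor)"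
proof -
  have no_divisor: "{j \<in> {1..r}. mon_dvd (m j) M} = {}"
    using assms(2) by (blast elim: cone_apex_exists)
  then show ?thesis
    unfolding hterm_def psi_term_vec psi_term_def prod.case mon_dvd_diff_add[OF assms(1)] no_divisor
    by simp
qed

lemma delta_cone:
  assumes "mon_dvd (mseq m ks) M" "mon_dvd (m i) M"
  shows "delta m (hterm m M (i # ks)) =
    hterm m M ks - (face_sum (\<lambda>ls. hterm m M (i # ls)) ks :: ('x, 'k::comm_ring_1) taylor)"
  using assms by (subst delta_hterm) (auto simp: mseq_mon_dvd_iff)

text \<open>
  Let \<open>i\<close> be the apex. If \<open>i\<close> is not the first entry of \<open>k\<close>, then \<open>\<psi>\<close> prepends \<open>i\<close> to \<open>k\<close> and to all its
  faces, and the claim is the recursion for \<open>\<delta>(i, k)\<close>. If \<open>k = (i, k')\<close>, then \<open>\<psi>\<close> kills \<open>k\<close> and all its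
  faces except \<open>k'\<close>, which it sends back to \<open>k\<close>.
\<close>

lemma homotopy_hterm:
  assumes ks: "ks \<in> ascending r (Suc q)" and M: "mon_dvd (mseq m ks) M"
  shows "delta m (psi r m (hterm m M ks)) + psi r m (delta m (hterm m M ks)) =
    (hterm m M ks :: ('x, 'k::comm_ring_1) taylor)"
proof -
  obtain k ks' where kk: "ks = k # ks'"
    using ks by (cases ks) (auto simp: ascending_def)
  then have "k \<in> {1..r}" "mon_dvd (m k) M"
    using ks M by (auto simp: ascending_def mseq_mon_dvd_iff)
  then obtain i where i: "cone_apex r m M i" "i \<le> k"
    by (rule cone_apex_exists)
  have faces: "mon_dvd (mseq m (remove_at l ks)) M" for l
    using mseq_mon_dvd_mono[OF set_remove_at M] .
  have psi_delta: "psi r m (delta m (hterm m M ks)) =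
      face_sum (\<lambda>ls. psi r m (hterm m M ls) :: ('x, 'k) taylor) ks"
    using M by (simp add: delta_hterm klinear_face_sum[OF klinear_psi])
  show ?thesis
  proof (cases "i = k")
    case False
    have lt: "i < j" if "j \<in> set ks" for j
      using that i False ks by (auto simp: kk ascending_def)
    then have "i < hd (remove_at l ks)" if "remove_at l ks \<noteq> []" for l
      using that set_remove_at[of l ks] hd_in_set by blast
    then have "face_sum (\<lambda>ls. psi r m (hterm m M ls)) ks =
        (face_sum (\<lambda>ls. hterm m M (i # ls)) ks :: ('x, 'k) taylor)"
      using i faces by (intro face_sum_cong) (auto simp: psi_hterm)
    moreover have "delta m (psi r m (hterm m M ks)) =
        hterm m M ks - (face_sum (\<lambda>ls. hterm m M (i # ls)) ks :: ('x, 'k) taylor)"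
      using i M False delta_cone[of m ks M i]
      by (simp add: psi_hterm[OF M i(1)] cone_apex_def) (simp add: kk)
    ultimately show ?thesis
      by (simp add: psi_delta)
  next
    case True
    interpret d: module_hom cscale cscale "delta m :: ('x, 'k) taylor \<Rightarrow> _"
      by (rule klinear_delta)
    have "ks' = [] \<or> i < hd ks'"
      using ks by (cases ks') (auto simp: kk True ascending_def)
    moreover have "mon_dvd (mseq m ks') M"
      using M by (simp add: kk mseq_mon_dvd_iff)
    ultimately have "psi r m (hterm m M ks') = (hterm m M ks :: ('x, 'k) taylor)"
      by (simp add: psi_hterm[OF _ i(1)] kk True)
    moreover have "face_sum (\<lambda>ls. psi r m (hterm m M (k # ls)) :: ('x, 'k) taylor) ks' =
        face_sum (\<lambda>_. 0) ks'"
    proof (intro face_sum_cong)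
      fix l
      show "psi r m (hterm m M (k # remove_at l ks')) = (0 :: ('x, 'k) taylor)"
        using psi_hterm[OF _ i(1), of "k # remove_at l ks'"] faces[of "Suc l"] by (simp add: kk True)
    qed
    moreover have "psi r m (hterm m M ks) = (0 :: ('x, 'k) taylor)"
      using psi_hterm[OF M i(1)] by (simp add: kk True)
    ultimately show ?thesis
      by (simp add: psi_delta face_sum_zero) (simp add: kk)
  qed
qed

lemma homotopy:
  assumes "v \<in> Tay r (Suc q)"
  shows "delta m (psi r m v) + psi r m (delta m v) = (v :: ('x, 'k::comm_ring_1) taylor)"
proof -
  note comp = module_hom_compose[unfolded comp_def]
  have "klinear (\<lambda>v. delta m (psi r m v) + psi r m (delta m v) :: ('x, 'k) taylor)"
    by (intro cmod_pair.module_hom_add comp[OF klinear_psi klinear_delta] comp[OF klinear_delta klinear_psi])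
  then show ?thesis
  proof (rule klinear_eqI[OF _ cmod.module_hom_ident])
    fix a assume "a \<in> terms v"
    then have "snd a \<in> ascending r (Suc q)"
      using assms by (auto simp: Tay_iff_terms)
    from homotopy_hterm[OF this mseq_mon_dvd_add[of m _ "fst a"]]
    show "delta m (psi r m (term_vec a)) + psi r m (delta m (term_vec a)) = (term_vec a :: ('x, 'k) taylor)"
      by (cases a) (simp add: term_vec_eq_hterm[of _ _ m])
  qed
qed

lemma delta_delta: "delta m (delta m v) = (0 :: ('x, 'k::comm_ring_1) taylor)"
proof (rule klinear_eqI[of "\<lambda>v. delta m (delta m v)" "\<lambda>_. 0" v])
  show "klinear (\<lambda>v. delta m (delta m v) :: ('x, 'k) taylor)"
    using module_hom_compose[OF klinear_delta klinear_delta] by (simp add: comp_def)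
  show "klinear (\<lambda>_. 0 :: ('x, 'k) taylor)"
    by (rule cmod_pair.module_hom_zero)
  fix a :: "'x monomial \<times> nat list"
  have "delta m (delta m (hterm m M ks)) = (0 :: ('x, 'k) taylor)"
    if M: "mon_dvd (mseq m ks) M" for M ks
  proof -
    have "face_sum (\<lambda>ls. delta m (hterm m M ls)) ks =
        (face_sum (face_sum (hterm m M)) ks :: ('x, 'k) taylor)"
      by (intro face_sum_cong delta_hterm mseq_mon_dvd_mono[OF set_remove_at M])
    then show ?thesis
      using M by (simp add: delta_hterm klinear_face_sum[OF klinear_delta] face_sum_face_sum)
  qed
  from this[OF mseq_mon_dvd_add[of m "snd a" "fst a"]]
  show "delta m (delta m (term_vec a)) = (0 :: ('x, 'k) taylor)"
    by (cases a) (simp add: term_vec_eq_hterm[of _ _ m])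
qed

section \<open>The induced term orders\<close>

text \<open>
  The multidegree \<open>x\<^sup>\<mu> m\<^sub>k\<close> of the term \<open>x\<^sup>\<mu> v\<^sub>k\<close>.
\<close>

definition tdeg :: "(nat \<Rightarrow> 'x monomial) \<Rightarrow> 'x monomial \<times> nat list \<Rightarrow> 'x monomial" where
  "tdeg m a = fst a + mseq m (snd a)"

lemma tdeg_pair [simp]: "mon_dvd (mseq m ks) M \<Longrightarrow> tdeg m (M - mseq m ks, ks) = M"
  by (simp add: tdeg_def mon_dvd_diff_add)

lemma mseq_mon_dvd_tdeg [simp]: "mon_dvd (mseq m (snd a)) (tdeg m a)"
  by (simp add: tdeg_def)

lemma term_eqI: "tdeg m a = tdeg m b \<Longrightarrow> snd a = snd b \<Longrightarrow> a = b"
  by (simp add: tdeg_def prod_eq_iff)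

lemma term_vec_hterm: "term_vec a = hterm m (tdeg m a) (snd a)"
  by (simp add: tdeg_def hterm_def)

lemma terms_hterm: "terms (hterm m M ks :: ('x, 'k::comm_ring_1) taylor) = {(M - mseq m ks, ks)}"
  by (simp add: hterm_def terms_term_vec)

text \<open>
  Unfolding the recursive definition of \<open>\<prec>\<^sub>q\<close> deletes first entries one by one, so sequences get
  compared from the right: the tails decide first.
\<close>

fun colex :: "nat list \<Rightarrow> nat list \<Rightarrow> bool" where
  "colex (k # ks) (l # ls) \<longleftrightarrow> colex ks ls \<or> ks = ls \<and> k < l"
| "colex _ _ \<longleftrightarrow> False"

lemma colex_irrefl: "\<not> colex ks ks"
  by (induction ks) auto

lemma colex_trans: "colex ks ls \<Longrightarrow> colex ls js \<Longrightarrow> colex ks js"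
proof (induction ks ls arbitrary: js rule: colex.induct)
  case (1 k ks l ls)
  then show ?case
    by (cases js) auto
qed auto

lemma colex_total: "length ks = length ls \<Longrightarrow> ks \<noteq> ls \<Longrightarrow> colex ks ls \<or> colex ls ks"
  by (induction ks ls rule: list_induct2) auto

text \<open>
  Why the face opposite to the smallest vertex carries the leading term: deleting any later entry
  instead shifts the smaller entries to the right, up to the gap.
\<close>

lemma colex_face:
  "l < length ks \<Longrightarrow> sorted_wrt (<) (i # ks) \<Longrightarrow> colex (i # remove_at l ks) ks"
proof (induction ks arbitrary: i l)
  case (Cons k ks)
  then show ?case
    by (cases l) auto
qed simp

text \<open>
  The closed form of the orders \<open>\<prec>\<^sub>q\<close>, the same for all \<open>q\<close>.
\<close>

definition homog_less :: "(nat \<Rightarrow> 'x monomial) \<Rightarrow> ('x monomial \<Rightarrow> 'x monomial \<Rightarrow> bool) \<Rightarrow>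
    'x monomial \<times> nat list \<Rightarrow> 'x monomial \<times> nat list \<Rightarrow> bool" where
  "homog_less m prec0 a b \<longleftrightarrow>
     prec0 (tdeg m a) (tdeg m b) \<or> tdeg m a = tdeg m b \<and> colex (snd a) (snd b)"

context
  fixes prec0 :: "'x monomial \<Rightarrow> 'x monomial \<Rightarrow> bool"
  assumes order: "is_term_order prec0"
begin

lemma term_order_irrefl: "\<not> prec0 s s"
  and term_order_trans: "prec0 s t \<Longrightarrow> prec0 t u \<Longrightarrow> prec0 s u"
  and term_order_total: "s \<noteq> t \<Longrightarrow> prec0 s t \<or> prec0 t s"
  using order[unfolded is_term_order_def] by iprover+

lemma homog_less_irrefl: "\<not> homog_less m prec0 a a"
  by (simp add: homog_less_def colex_irrefl term_order_irrefl)

lemma homog_less_trans: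
  assumes "homog_less m prec0 a b" "homog_less m prec0 b c"
  shows "homog_less m prec0 a c"
  using assms term_order_trans[of "tdeg m a" "tdeg m b" "tdeg m c"] colex_trans[of "snd a" "snd b" "snd c"]
  by (auto simp: homog_less_def)

lemma homog_less_asym: "homog_less m prec0 a b \<Longrightarrow> \<not> homog_less m prec0 b a"
  using homog_less_irrefl[of m a] homog_less_trans[of m a b a] by iprover

lemma homog_less_total:
  assumes "length (snd a) = length (snd b)" "a \<noteq> b"
  shows "homog_less m prec0 a b \<or> homog_less m prec0 b a"
proof (cases "tdeg m a = tdeg m b")
  case True
  then have "snd a \<noteq> snd b"
    using assms term_eqI by blast
  with True show ?thesis
    using assms colex_total[of "snd a" "snd b"] by (auto simp: homog_less_def)
next
  case False
  then show ?thesis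
    using term_order_total by (auto simp: homog_less_def)
qed

lemma finite_homog_maximum:
  assumes "finite A" "A \<noteq> {}" "\<And>a. a \<in> A \<Longrightarrow> length (snd a) = q"
  obtains a where "a \<in> A" "\<And>b. b \<in> A \<Longrightarrow> b \<noteq> a \<Longrightarrow> homog_less m prec0 b a"
proof -
  have "\<exists>a\<in>A. \<forall>b\<in>A. b \<noteq> a \<longrightarrow> homog_less m prec0 b a"
    using assms
  proof (induction A rule: finite_ne_induct)
    case (insert x A)
    then obtain a where a: "a \<in> A" "\<forall>b\<in>A. b \<noteq> a \<longrightarrow> homog_less m prec0 b a"
      by auto
    moreover have "x \<noteq> a"
      using insert.hyps a by auto
    ultimately consider "homog_less m prec0 x a" | "homog_less m prec0 a x"
      using homog_less_total[of x a m] insert.prems by auto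
    then show ?case
    proof cases
      case 1
      with a show ?thesis by auto
    next
      case 2
      with a show ?thesis
        by (metis homog_less_trans insert_iff)
    qed
  qed simp
  then show thesis
    using that by blast
qed

end

text \<open>
  All terms of the boundary have multidegree \<open>M\<close>, so the order among them is \<open>colex\<close>, and the
  face \<open>ks\<close> leads.
\<close>

lemma delta_hterm_Cons:
  fixes D :: "('x, 'k::comm_ring_1) taylor"
  assumes asc: "i # ks \<in> ascending r (Suc q)" and M: "mon_dvd (mseq m (i # ks)) M"
  defines "D \<equiv> delta m (hterm m M (i # ks))" and "a \<equiv> (M - mseq m ks, ks)"
  shows "D \<in> Tay r q" "coef D a = 1" "\<And>b. b \<in> terms D \<Longrightarrow> b \<noteq> a \<Longrightarrow> homog_less m prec0 b a"
proof -
  let ?F = "face_sum (\<lambda>ls. hterm m M (i # ls)) ks :: ('x, 'k) taylor"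
  have Mks: "mon_dvd (mseq m ks) M" and Mi: "mon_dvd (m i) M"
    using M by (simp_all add: mseq_mon_dvd_iff)
  have D: "D = hterm m M ks - ?F"
    unfolding D_def by (rule delta_cone[OF Mks Mi])
  have F: "\<exists>l<length ks. b = (M - mseq m (i # remove_at l ks), i # remove_at l ks)"
    if "b \<in> terms ?F" for b
    using that terms_face_sum[of "\<lambda>ls. hterm m M (i # ls) :: ('x, 'k) taylor" ks] by (auto simp: terms_hterm)
  have less: "homog_less m prec0 b a \<and> snd b \<in> ascending r q \<and> snd b \<noteq> ks" if bF: "b \<in> terms ?F" for b
  proof -
    obtain l where l: "l < length ks" and b: "b = (M - mseq m (i # remove_at l ks), i # remove_at l ks)"
      using F[OF bF] by blast
    have "mon_dvd (mseq m (i # remove_at l ks)) M"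
      using set_remove_at[of l ks] by (intro mseq_mon_dvd_mono[OF _ M]) auto
    then have "tdeg m b = M" "tdeg m a = M"
      using Mks by (simp_all add: a_def b)
    moreover have "colex (snd b) ks"
      unfolding b snd_conv using asc l by (intro colex_face) (auto simp: ascending_def)
    moreover have "snd b \<in> ascending r q"
      using ascending_remove_at[OF asc, of "Suc l"] l asc by (simp add: b ascending_def)
    ultimately show ?thesis
      by (auto simp: homog_less_def a_def colex_irrefl)
  qed
  have termsD: "terms D \<subseteq> insert a (terms ?F)"
    unfolding D using terms_diff[of "hterm m M ks" ?F] by (auto simp: terms_hterm a_def)
  show "D \<in> Tay r q"
    using termsD less asc by (auto simp: Tay_iff_terms a_def ascending_Cons_iff)
  have "a \<notin> terms ?F"
    using less[of a] by (simp add: a_def) blast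
  then have "coef ?F a = 0"
    by (simp add: mem_terms_iff)
  then show "coef D a = 1"
    by (simp add: D coef_diff) (simp add: hterm_def coef_term_vec a_def)
  show "homog_less m prec0 b a" if "b \<in> terms D" "b \<noteq> a" for b
    using that termsD less[of b] by blast
qed

lemma lead_term_eqI:
  assumes "a \<in> terms v" "\<And>b. b \<in> terms v \<Longrightarrow> b \<noteq> a \<Longrightarrow> prec b a \<and> \<not> prec a b"
  shows "lead_term prec v = a"
  unfolding lead_term_def using assms by (intro the_equality) metis+

text \<open>
  By induction on \<open>q\<close>: once \<open>\<prec>\<^sub>q\<close> has the closed form, the leading term of \<open>s \<delta> v\<^sub>k\<close> is found by
  deleting the first entry of \<open>k\<close> at unchanged multidegree, so \<open>\<prec>\<^sub>q\<^sub>+\<^sub>1\<close> compares multidegrees, then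
  tails, then first entries.
\<close>

lemma tless_iff_homog_less:
  fixes m :: "nat \<Rightarrow> 'x monomial"
  assumes order: "is_term_order prec0" and "snd a \<in> ascending r q" "snd b \<in> ascending r q"
  shows "tless TYPE('k::comm_ring_1) m prec0 q a b \<longleftrightarrow> homog_less m prec0 a b"
  using assms(2,3)
proof (induction q arbitrary: a b)
  case 0
  then show ?case
    by (auto simp: ascending_def homog_less_def tdeg_def mseq_def)
next
  case (Suc q)
  have lead: "lead_term (tless TYPE('k) m prec0 q)
      (scale (Poly_Mapping.single s 1) (delta_basis m (k # ks)) :: ('x, 'k) taylor) =
      (tdeg m (s, k # ks) - mseq m ks, ks)" (is "lead_term _ ?D = ?a")
    if asc: "k # ks \<in> ascending r (Suc q)" for s k ks
  proof (rule lead_term_eqI)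
    have D: "?D = delta m (hterm m (tdeg m (s, k # ks)) (k # ks))"
      by (simp add: delta_term_vec[symmetric] term_vec_hterm[of "(s, k # ks)" m])
    have "mon_dvd (mseq m (k # ks)) (tdeg m (s, k # ks))"
      by (simp add: tdeg_def)
    note Cons = delta_hterm_Cons[OF asc this, where 'k = 'k, folded D]
    show "?a \<in> terms ?D"
      using Cons(2) by (simp add: mem_terms_iff)
    fix b assume b: "b \<in> terms ?D" "b \<noteq> ?a"
    then have "snd b \<in> ascending r q"
      using Cons(1) by (auto simp: Tay_iff_terms)
    moreover have "snd ?a \<in> ascending r q"
      using asc by (simp add: ascending_Cons_iff)
    ultimately show "tless TYPE('k) m prec0 q b ?a \<and> \<not> tless TYPE('k) m prec0 q ?a b"
      using Cons(3)[OF b, of prec0] homog_less_asym[OF order] by (simp add: Suc.IH)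
  qed
  obtain s k ks t l ls where ab: "a = (s, k # ks)" "b = (t, l # ls)"
    using Suc.prems by (cases a; cases b; cases "snd a"; cases "snd b") (auto simp: ascending_def)
  have asc: "ks \<in> ascending r q" "ls \<in> ascending r q" "length ks = length ls"
    using Suc.prems by (auto simp: ab ascending_def)
  have dvd: "mon_dvd (mseq m ks) (tdeg m a)" "mon_dvd (mseq m ls) (tdeg m b)"
    using mseq_mon_dvd_tdeg[of m a] mseq_mon_dvd_tdeg[of m b]
    by (auto simp: ab mseq_mon_dvd_iff)
  let ?a = "(tdeg m a - mseq m ks, ks)" and ?b = "(tdeg m b - mseq m ls, ls)"
  have eq: "?a = ?b \<longleftrightarrow> tdeg m a = tdeg m b \<and> ks = ls"
  proof
    assume ab': "?a = ?b"
    then have "tdeg m ?a = tdeg m ?b"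
      by (rule arg_cong)
    then show "tdeg m a = tdeg m b \<and> ks = ls"
      unfolding tdeg_pair[OF dvd(1)] tdeg_pair[OF dvd(2)] using ab' by blast
  qed simp
  have "(ls, ls) \<notin> lex less_than"
    by (rule wf_not_refl[OF wf_lex[OF wf_less_than]])
  then have lex: "ks = ls \<Longrightarrow> (k # ks, l # ls) \<in> lex less_than \<longleftrightarrow> k < l"
    by simp
  have "tless TYPE('k) m prec0 (Suc q) a b \<longleftrightarrow>
      tless TYPE('k) m prec0 q ?a ?b \<or> ?a = ?b \<and> (k # ks, l # ls) \<in> lex less_than"
    using lead[of k ks s] lead[of l ls t] Suc.prems by (simp add: ab)
  also have "\<dots> \<longleftrightarrow> homog_less m prec0 ?a ?b \<or> tdeg m a = tdeg m b \<and> ks = ls \<and> k < l"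
    using lex unfolding eq by (auto simp: Suc.IH asc)
  also have "\<dots> \<longleftrightarrow> homog_less m prec0 a b"
    using dvd by (auto simp: homog_less_def) (auto simp: ab)
  finally show ?case .
qed

lemma lead_term_tless_eqI:
  assumes order: "is_term_order prec0" and v: "v \<in> Tay r q" and a: "a \<in> terms v"
    and max: "\<And>b. b \<in> terms v \<Longrightarrow> b \<noteq> a \<Longrightarrow> homog_less m prec0 b a"
  shows "lead_term (tless TYPE('k::comm_ring_1) m prec0 q) v = a"
proof (rule lead_term_eqI[OF a])
  fix b assume b: "b \<in> terms v" "b \<noteq> a"
  then have "snd a \<in> ascending r q" "snd b \<in> ascending r q"
    using a v by (auto simp: Tay_iff_terms)
  then show "tless TYPE('k) m prec0 q b a \<and> \<not> tless TYPE('k) m prec0 q a b"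
    using max[OF b] homog_less_asym[OF order] by (simp add: tless_iff_homog_less[OF order])
qed

section \<open>Reducible terms and the projector\<close>

text \<open>
  These turn out to be the terms in the leading module of \<open>J\<^sub>q\<close>. For nonempty \<open>k\<close> the condition says
  that \<open>\<iota> < k\<^sub>1\<close>; for empty \<open>k\<close>, that \<open>\<iota>\<close> exists.
\<close>

definition reducible :: "nat \<Rightarrow> (nat \<Rightarrow> 'x monomial) \<Rightarrow> 'x monomial \<times> nat list \<Rightarrow> bool" where
  "reducible r m a \<longleftrightarrow>
     (\<exists>i\<in>{1..r}. mon_dvd (m i) (tdeg m a) \<and> (snd a = [] \<or> i < hd (snd a)))"

lemma reducible_mult: "reducible r m (s, ks) \<Longrightarrow> reducible r m (u + s, ks)"
  by (auto simp: reducible_def tdeg_def add.assoc intro!: mon_dvd_add_left)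

lemma psi_irreducible:
  assumes "\<not> reducible r m a"
  shows "psi r m (term_vec a) = (0 :: ('x, 'k::comm_ring_1) taylor)"
proof (cases "\<exists>i. cone_apex r m (tdeg m a) i")
  case True
  then obtain i where i: "cone_apex r m (tdeg m a) i" ..
  then have "\<not> (snd a = [] \<or> i < hd (snd a))"
    using assms by (auto simp: reducible_def cone_apex_def)
  then show ?thesis
    by (simp add: term_vec_hterm[of _ m] psi_hterm[OF _ i])
next
  case False
  then show ?thesis
    by (simp add: term_vec_hterm[of _ m] psi_hterm_no_apex)
qed

lemma psi_reducible:
  assumes "reducible r m a" "snd a \<in> ascending r q"
  obtains i where "cone_apex r m (tdeg m a) i" "i # snd a \<in> ascending r (Suc q)"
    "mon_dvd (mseq m (i # snd a)) (tdeg m a)"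
    "psi r m (term_vec a) = (hterm m (tdeg m a) (i # snd a) :: ('x, 'k::comm_ring_1) taylor)"
proof -
  obtain j where j: "j \<in> {1..r}" "mon_dvd (m j) (tdeg m a)" "snd a = [] \<or> j < hd (snd a)"
    using assms(1) by (auto simp: reducible_def)
  obtain i where i: "cone_apex r m (tdeg m a) i" "i \<le> j"
    using j(1,2) by (rule cone_apex_exists)
  have lt: "snd a = [] \<or> i < hd (snd a)"
    using i j by auto
  show thesis
  proof (rule that[OF i(1)])
    show "i # snd a \<in> ascending r (Suc q)"
      using assms(2) i lt by (intro ascending_Cons_hd) (auto simp: cone_apex_def)
    show "mon_dvd (mseq m (i # snd a)) (tdeg m a)"
      using i mseq_mon_dvd_tdeg[of m a] by (auto simp: cone_apex_def mseq_mon_dvd_iff)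
    show "psi r m (term_vec a) = (hterm m (tdeg m a) (i # snd a) :: ('x, 'k) taylor)"
      using lt by (simp add: term_vec_hterm[of _ m] psi_hterm[OF _ i(1)])
  qed
qed

text \<open>
  A term produced by \<open>\<psi>\<close> starts with the smallest index of a divisor of its multidegree, so no
  smaller index is left to reduce it.
\<close>

lemma terms_psi:
  assumes v: "v \<in> Tay r q" and b: "b \<in> terms (psi r m v :: ('x, 'k::comm_ring_1) taylor)"
  shows "snd b \<in> ascending r (Suc q)" "\<not> reducible r m b"
proof -
  obtain a where a: "a \<in> terms v" "b \<in> terms (psi r m (term_vec a) :: ('x, 'k) taylor)"
    using klinear_terms[OF klinear_psi, of r m v] b by blast
  have "reducible r m a"
    by (rule ccontr) (use a(2) in \<open>simp add: psi_irreducible\<close>)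
  moreover have "snd a \<in> ascending r q"
    using a v by (auto simp: Tay_iff_terms)
  ultimately obtain i where i: "cone_apex r m (tdeg m a) i" "i # snd a \<in> ascending r (Suc q)"
    "mon_dvd (mseq m (i # snd a)) (tdeg m a)"
    "psi r m (term_vec a) = (hterm m (tdeg m a) (i # snd a) :: ('x, 'k) taylor)"
    by (rule psi_reducible)
  then have b_eq: "b = (tdeg m a - mseq m (i # snd a), i # snd a)"
    using a(2) by (simp add: terms_hterm)
  then show "snd b \<in> ascending r (Suc q)"
    using i(2) by simp
  have "tdeg m b = tdeg m a"
    using i(3) by (simp add: b_eq)
  then show "\<not> reducible r m b"
    using i(1) by (force simp: reducible_def b_eq cone_apex_def)
qed

lemma psi_Tay: "v \<in> Tay r q \<Longrightarrow> psi r m v \<in> (Tay r (Suc q) :: ('x, 'k::comm_ring_1) taylor set)"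
  using terms_psi(1)[of v r q _ m] by (auto simp: Tay_iff_terms)

lemma klinear_delta_psi: "klinear (delta_psi r m :: ('x, 'k::comm_ring_1) taylor \<Rightarrow> _)"
  using module_hom_compose[OF klinear_psi klinear_delta] by (simp add: comp_def delta_psi_def[abs_def])

lemma delta_psi_irreducible:
  assumes "\<not> reducible r m a"
  shows "delta_psi r m (term_vec a) = (0 :: ('x, 'k::comm_ring_1) taylor)"
proof -
  interpret module_hom cscale cscale "delta m :: ('x, 'k) taylor \<Rightarrow> _"
    by (rule klinear_delta)
  show ?thesis
    by (simp add: delta_psi_def psi_irreducible[OF assms])
qed

lemma delta_psi_reducible:
  fixes m :: "nat \<Rightarrow> 'x monomial" and D :: "('x, 'k::comm_ring_1) taylor"
  assumes a: "reducible r m a" "snd a \<in> ascending r q"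
  defines "D \<equiv> delta_psi r m (term_vec a)"
  shows "D \<in> Tay r q" "coef D a = 1" "\<And>b. b \<in> terms D \<Longrightarrow> b \<noteq> a \<Longrightarrow> homog_less m prec0 b a"
proof -
  obtain i where i: "cone_apex r m (tdeg m a) i" "i # snd a \<in> ascending r (Suc q)"
    "mon_dvd (mseq m (i # snd a)) (tdeg m a)"
    "psi r m (term_vec a) = (hterm m (tdeg m a) (i # snd a) :: ('x, 'k) taylor)"
    using a by (rule psi_reducible)
  have D: "D = delta m (hterm m (tdeg m a) (i # snd a))"
    by (simp add: D_def delta_psi_def i(4))
  have a_eq: "(tdeg m a - mseq m (snd a), snd a) = a"
    by (simp add: tdeg_def prod_eq_iff)
  note Cons = delta_hterm_Cons[OF i(2,3), where 'k = 'k, folded D, unfolded a_eq]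
  show "D \<in> Tay r q" "coef D a = 1"
    by (fact Cons(1), fact Cons(2))
  show "homog_less m prec0 b a" if "b \<in> terms D" "b \<noteq> a" for b
    using Cons(3)[OF that] .
qed

lemma delta_psi_reducible_0:
  assumes "reducible r m a" "snd a = []"
  shows "delta_psi r m (term_vec a) = (term_vec a :: ('x, 'k::comm_ring_1) taylor)"
proof -
  have "snd a \<in> ascending r 0"
    using assms by (simp add: ascending_def)
  with assms(1) obtain i where "mon_dvd (mseq m (i # snd a)) (tdeg m a)"
    "psi r m (term_vec a) = (hterm m (tdeg m a) (i # snd a) :: ('x, 'k) taylor)"
    by (rule psi_reducible)
  then show ?thesis
    using assms(2) by (simp add: delta_psi_def delta_hterm term_vec_hterm[of a m])
qed

lemma Tay_subspace: "taylor.subspace (Tay r q :: ('x, 'k::comm_ring_1) taylor set)"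
  unfolding span_basis_vec[symmetric] by (rule taylor.subspace_span)

lemma J_subspace: "taylor.subspace (J r m q :: ('x, 'k::comm_ring_1) taylor set)"
  unfolding span_Delta[symmetric] by (rule taylor.subspace_span)

lemma delta_psi_in_J: "v \<in> Tay r q \<Longrightarrow> delta_psi r m v \<in> (J r m q :: ('x, 'k::comm_ring_1) taylor set)"
  by (auto simp: J_def delta_psi_def psi_Tay)

text \<open>
  Apply \<open>\<delta>\<close> to \<open>\<delta>\<psi>w + \<psi>\<delta>w = w\<close>: since \<open>\<delta>\<delta> = 0\<close>, this gives \<open>\<delta>\<psi>\<delta> = \<delta>\<close>. The homotopy is used one
  degree above \<open>q\<close>, so degree \<open>0\<close> needs no special treatment here.
\<close>

lemma delta_psi_J:
  assumes "u \<in> J r m q"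
  shows "delta_psi r m u = (u :: ('x, 'k::comm_ring_1) taylor)"
proof -
  interpret module_hom cscale cscale "delta m :: ('x, 'k) taylor \<Rightarrow> _"
    by (rule klinear_delta)
  obtain w where w: "w \<in> Tay r (Suc q)" "u = delta m w"
    using assms by (auto simp: J_def)
  have "delta m (delta m (psi r m w) + psi r m (delta m w)) = delta m w"
    by (simp only: homotopy[OF w(1)])
  then show ?thesis
    by (simp add: add delta_delta delta_psi_def w(2))
qed

lemma delta_psi_Tay:
  fixes m :: "nat \<Rightarrow> 'x monomial"
  assumes "v \<in> Tay r q"
  shows "delta_psi r m v \<in> (Tay r q :: ('x, 'k::comm_ring_1) taylor set)"
proof -
  have "snd b \<in> ascending r q" if b: "b \<in> terms (delta_psi r m v)" for b
  proof -
    obtain a where a: "a \<in> terms v" "b \<in> terms (delta_psi r m (term_vec a) :: ('x, 'k) taylor)"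
      using klinear_terms[OF klinear_delta_psi, of r m v] b by blast
    have "reducible r m a"
      by (rule ccontr) (use a(2) in \<open>simp add: delta_psi_irreducible\<close>)
    moreover have "snd a \<in> ascending r q"
      using a assms by (auto simp: Tay_iff_terms)
    ultimately show ?thesis
      using delta_psi_reducible(1)[of r m a q, where 'k = 'k] a(2) by (auto simp: Tay_iff_terms)
  qed
  then show ?thesis
    by (auto simp: Tay_iff_terms)
qed

lemma J_subset_Tay: "J r m q \<subseteq> (Tay r q :: ('x, 'k::comm_ring_1) taylor set)"
proof
  fix u :: "('x, 'k) taylor" assume u: "u \<in> J r m q"
  have "Delta r m q \<subseteq> (Tay r q :: ('x, 'k) taylor set)"
  proof
    fix d :: "('x, 'k) taylor" assume "d \<in> Delta r m q"
    then obtain ks where ks: "ks \<in> ascending r (Suc q)" "d = delta_basis m ks"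
      by (auto simp: Delta_def)
    then obtain k ks' where "ks = k # ks'"
      by (cases ks) (auto simp: ascending_def)
    moreover have "d = delta m (hterm m (mseq m ks) ks)"
      by (simp add: ks hterm_def delta_basis_vec flip: basis_vec_def)
    ultimately show "d \<in> Tay r q"
      using delta_hterm_Cons(1)[of k ks' r q m "mseq m ks"] ks mseq_mon_dvd_add[of m ks 0] by simp
  qed
  then have "taylor.span (Delta r m q) \<subseteq> (Tay r q :: ('x, 'k) taylor set)"
    by (rule taylor.span_minimal[OF _ Tay_subspace])
  then show "u \<in> Tay r q"
    using u by (auto simp: span_Delta)
qed

text \<open>
  On irreducible terms \<open>\<psi>\<close> vanishes, while \<open>\<delta>\<psi>\<close> is the identity on \<open>J\<^sub>q\<close>.
\<close>

lemma irreducible_J_eq_0: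
  assumes "u \<in> J r m q" "\<And>a. a \<in> terms u \<Longrightarrow> \<not> reducible r m a"
  shows "u = (0 :: ('x, 'k::comm_ring_1) taylor)"
proof -
  have "delta_psi r m u = 0"
    by (rule klinear_eqI[OF klinear_delta_psi cmod_pair.module_hom_zero])
      (rule delta_psi_irreducible[OF assms(2)])
  then show ?thesis
    using delta_psi_J[OF assms(1)] by simp
qed

lemma klinear_normal_part: "klinear (\<lambda>v. v - delta_psi r m v :: ('x, 'k::comm_ring_1) taylor)"
  by (intro cmod_pair.module_hom_sub cmod.module_hom_ident klinear_delta_psi)

text \<open>
  In positive degree \<open>v - \<delta>\<psi>v = \<psi>(\<delta>v)\<close> is an image under \<open>\<psi>\<close>. In degree \<open>0\<close> a reducible term
  \<open>x\<^sup>\<mu>\<close> has \<open>\<delta>\<psi>(x\<^sup>\<mu>) = x\<^sup>\<mu>\<close>, so it contributes nothing.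
\<close>

lemma normal_part_irreducible:
  fixes m :: "nat \<Rightarrow> 'x monomial"
  assumes v: "v \<in> Tay r q" and a: "a \<in> terms (v - delta_psi r m v :: ('x, 'k::comm_ring_1) taylor)"
  shows "\<not> reducible r m a"
proof (cases q)
  case (Suc p)
  have "delta m v \<in> J r m p"
    using v by (auto simp: Suc J_def)
  then have "delta m v \<in> Tay r p"
    using J_subset_Tay by blast
  moreover have "v - delta_psi r m v = psi r m (delta m v)"
    using homotopy[of v r p m] v by (simp add: Suc delta_psi_def algebra_simps)
  ultimately show ?thesis
    using a by (intro terms_psi(2)) simp_all
next
  case 0
  obtain b where b: "b \<in> terms v" "a \<in> terms (term_vec b - delta_psi r m (term_vec b) :: ('x, 'k) taylor)"
    using klinear_terms[OF klinear_normal_part, of v r m] a by blast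
  have "snd b = []"
    using v b by (auto simp: Tay_iff_terms 0 ascending_def)
  show ?thesis
  proof (cases "reducible r m b")
    case True
    then have "delta_psi r m (term_vec b) = (term_vec b :: ('x, 'k) taylor)"
      using \<open>snd b = []\<close> by (rule delta_psi_reducible_0)
    then show ?thesis
      using b(2) by simp
  next
    case False
    then show ?thesis
      using b(2) by (simp add: delta_psi_irreducible terms_term_vec)
  qed
qed

section \<open>The leading module of the boundaries\<close>

text \<open>
  The Groebner basis property. The map \<open>1 - \<delta>\<psi>\<close> kills \<open>u\<close>. If the largest term \<open>a\<close> of \<open>u\<close> were
  irreducible, it would survive this map with its coefficient: the other irreducible terms are fixed, and
  reducible terms of \<open>u\<close> become sums of terms below themselves, hence below \<open>a\<close>, so nothing can
  cancel it.
\<close>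

lemma leading_term_J_reducible:
  fixes u :: "('x, 'k::comm_ring_1) taylor"
  assumes order: "is_term_order prec0"
    and u: "u \<in> J r m q" and a: "a \<in> terms u"
    and max: "\<And>b. b \<in> terms u \<Longrightarrow> b \<noteq> a \<Longrightarrow> homog_less m prec0 b a"
  shows "reducible r m a"
proof (rule ccontr)
  assume irred: "\<not> reducible r m a"
  let ?N = "\<lambda>v. v - delta_psi r m v :: ('x, 'k) taylor"
  have "coef (?N (term_vec b)) a = (if b = a then 1 else 0)" if "b \<in> terms u" for b
  proof (cases "reducible r m b")
    case False
    then show ?thesis
      by (simp add: delta_psi_irreducible coef_term_vec)
  next
    case True
    then have "b \<noteq> a"
      using irred by auto
    have "snd b \<in> ascending r q"
      using that u J_subset_Tay by (fastforce simp: Tay_iff_terms)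
    have "a \<notin> terms (delta_psi r m (term_vec b) :: ('x, 'k) taylor)"
    proof
      assume "a \<in> terms (delta_psi r m (term_vec b) :: ('x, 'k) taylor)"
      then have "homog_less m prec0 a b"
        using delta_psi_reducible(3)[OF True \<open>snd b \<in> ascending r q\<close>] \<open>b \<noteq> a\<close> by blast
      then show False
        using max[OF that \<open>b \<noteq> a\<close>] homog_less_asym[OF order] by blast
    qed
    then show ?thesis
      using \<open>b \<noteq> a\<close> by (simp add: coef_diff coef_term_vec mem_terms_iff)
  qed
  then have "coef (?N u) a = (\<Sum>b\<in>terms u. coef u b * (if b = a then 1 else 0))"
    by (subst klinear_expansion[OF klinear_normal_part, of u]) (simp add: coef_sum coef_cscale)
  also have "\<dots> = coef u a"
    using a by (simp add: if_distrib sum.delta finite_terms cong: if_cong)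
  finally show False
    using a delta_psi_J[OF u] by (simp add: mem_terms_iff)
qed

text \<open>
  Multiplying a term by a monomial keeps it reducible, so the elements all of whose terms are reducible
  form a submodule; it contains the leading terms of \<open>J\<^sub>q\<close>.
\<close>

lemma lt_module_terms_reducible:
  fixes v :: "('x, 'k::comm_ring_1) taylor"
  assumes order: "is_term_order prec0"
    and v: "v \<in> lt_module (tless TYPE('k) m prec0 q) (J r m q)" and a: "a \<in> terms v"
  shows "reducible r m a"
proof -
  let ?R = "{v :: ('x, 'k) taylor. \<forall>a\<in>terms v. reducible r m a}"
  have "taylor.subspace ?R"
    unfolding taylor.subspace_def
  proof (intro conjI ballI allI)
    fix p and v :: "('x, 'k) taylor" assume v: "v \<in> ?R"
    have "reducible r m a" if "a \<in> terms (scale p v)" for a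
    proof -
      obtain s ks where a: "a = (s, ks)"
        by (cases a)
      then have "s \<in> Poly_Mapping.keys (p * Poly_Mapping.lookup v ks)"
        using that by (simp add: terms_def lookup_scale in_keys_iff)
      then obtain t u where "s = t + u" "u \<in> Poly_Mapping.keys (Poly_Mapping.lookup v ks)"
        using keys_mult by blast
      then show ?thesis
        using v by (auto simp: a terms_def in_keys_iff intro!: reducible_mult)
    qed
    then show "scale p v \<in> ?R"
      by blast
  next
    fix v w :: "('x, 'k) taylor" assume "v \<in> ?R" "w \<in> ?R"
    moreover have "terms (v + w) \<subseteq> terms v \<union> terms w"
      by (auto simp: mem_terms_iff coef_add)
    ultimately show "v + w \<in> ?R"
      by blast
  qed simp
  moreover have "term_vec (lead_term (tless TYPE('k) m prec0 q) u) \<in> ?R"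
    if u: "u \<in> J r m q" "u \<noteq> 0" for u :: "('x, 'k) taylor"
  proof -
    have uT: "u \<in> Tay r q"
      using u J_subset_Tay by blast
    then have len: "\<And>a. a \<in> terms u \<Longrightarrow> length (snd a) = q"
      by (auto simp: Tay_iff_terms ascending_def)
    have "terms u \<noteq> {}"
      using u(2) by (simp add: terms_empty_iff)
    from finite_homog_maximum[OF order finite_terms this len]
    obtain a where a: "a \<in> terms u" "\<And>b. b \<in> terms u \<Longrightarrow> b \<noteq> a \<Longrightarrow> homog_less m prec0 b a"
      by blast
    then show ?thesis
      using leading_term_J_reducible[OF order u(1) a] lead_term_tless_eqI[OF order uT a, where 'k = 'k]
      by (simp add: terms_term_vec)
  qed
  ultimately have "lt_module (tless TYPE('k) m prec0 q) (J r m q) \<subseteq> ?R"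
    unfolding lt_module_def by (intro taylor.span_minimal) auto
  then show ?thesis
    using v a by blast
qed

text \<open>
  A reducible term is itself a leading term, namely of its image under \<open>\<delta>\<psi>\<close>.
\<close>

lemma reducible_in_lt_module:
  assumes order: "is_term_order prec0" and a: "reducible r m a" "snd a \<in> ascending r q"
  shows "term_vec a \<in> lt_module (tless TYPE('k) m prec0 q) (J r m q :: ('x, 'k::comm_ring_1) taylor set)"
proof -
  let ?D = "delta_psi r m (term_vec a) :: ('x, 'k) taylor"
  note D = delta_psi_reducible[OF a, where 'k = 'k]
  have "(term_vec a :: ('x, 'k) taylor) \<in> Tay r q"
    using a by (simp add: Tay_iff_terms terms_term_vec)
  then have "?D \<in> J r m q"
    by (rule delta_psi_in_J)
  moreover have aD: "a \<in> terms ?D"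
    using D(2) by (simp add: mem_terms_iff)
  moreover have "lead_term (tless TYPE('k) m prec0 q) ?D = a"
    using D(3) by (rule lead_term_tless_eqI[OF order D(1) aD])
  ultimately show ?thesis
    unfolding lt_module_def by (intro taylor.span_base) (force intro!: image_eqI[of _ _ ?D])
qed

lemma term_vec_in_lt_module_iff:
  assumes "is_term_order prec0" "snd a \<in> ascending r q"
  shows "term_vec a \<in> lt_module (tless TYPE('k) m prec0 q) (J r m q :: ('x, 'k::comm_ring_1) taylor set)
    \<longleftrightarrow> reducible r m a"
proof
  assume "term_vec a \<in> lt_module (tless TYPE('k) m prec0 q) (J r m q :: ('x, 'k) taylor set)"
  then show "reducible r m a"
    by (rule lt_module_terms_reducible[OF assms(1)]) (simp add: terms_term_vec)
qed (rule reducible_in_lt_module[OF assms(1) _ assms(2)])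

section \<open>Normal forms\<close>

lemma irreducible_representative_iff:
  fixes v :: "('x, 'k::comm_ring_1) taylor"
  assumes v: "v \<in> Tay r q"
  shows "w \<in> Tay r q \<and> v - w \<in> J r m q \<and> (\<forall>a\<in>terms w. \<not> reducible r m a)
    \<longleftrightarrow> w = v - delta_psi r m v" (is "?irr w \<longleftrightarrow> w = ?N")
proof -
  have "?N \<in> Tay r q"
    using taylor.subspace_diff[OF Tay_subspace v delta_psi_Tay[OF v]] .
  then have N: "?irr ?N"
    using v normal_part_irreducible[OF v] by (auto simp: delta_psi_in_J)
  have "w = ?N" if w: "?irr w"
  proof -
    have "(v - ?N) - (v - w) \<in> J r m q"
      by (rule taylor.subspace_diff[OF J_subspace]) (use N w in blast)+
    then have "w - ?N \<in> J r m q"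
      by (simp add: algebra_simps)
    moreover have "\<not> reducible r m a" if "a \<in> terms (w - ?N)" for a
      using that N w terms_diff[of w ?N] by blast
    ultimately have "w - ?N = 0"
      by (rule irreducible_J_eq_0)
    then show ?thesis
      by simp
  qed
  with N show ?thesis
    by blast
qed

lemma term_vec_in_J_0_iff:
  assumes "snd a = []"
  shows "term_vec a \<in> (J r m 0 :: ('x, 'k::comm_ring_1) taylor set) \<longleftrightarrow> reducible r m a"
proof
  assume "term_vec a \<in> (J r m 0 :: ('x, 'k) taylor set)"
  then show "reducible r m a"
    using irreducible_J_eq_0[of "term_vec a :: ('x, 'k) taylor" r m 0] terms_term_vec[of a, where 'k = 'k]
    by (cases "reducible r m a") simp_all
next
  assume red: "reducible r m a"
  let ?a = "term_vec a :: ('x, 'k) taylor"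
  have a: "?a \<in> Tay r 0"
    using assms by (simp add: Tay_iff_terms terms_term_vec ascending_def)
  show "?a \<in> J r m 0"
    using delta_psi_in_J[OF a, of m] by (simp add: delta_psi_reducible_0[OF red assms])
qed

text \<open>
  For \<open>q > 0\<close> this is the homotopy identity. For \<open>q = 0\<close> the augmented \<open>\<psi>\<close> selects from the coset of
  \<open>v\<close> the element without terms in \<open>J\<^sub>0\<close>, which are the reducible terms, and
  \<open>v - \<delta>\<psi>v\<close> is the only such element.
\<close>

lemma psi_delta_eq:
  fixes v :: "('x, 'k::comm_ring_1) taylor"
  assumes v: "v \<in> Tay r q"
  shows "psi_delta r m q v = v - delta_psi r m v"
proof (cases q)
  case (Suc p)
  then show ?thesis
    using homotopy[of v r p m] v by (simp add: psi_delta_def delta_psi_def algebra_simps)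
next
  case 0
  have "snd a = []" if "w \<in> Tay r 0" "a \<in> terms w" for w :: "('x, 'k) taylor" and a
    using that by (auto simp: Tay_iff_terms ascending_def)
  then have "w \<in> aug_delta r m v \<and> (\<forall>a\<in>terms w. term_vec a \<notin> (J r m 0 :: ('x, 'k) taylor set))
      \<longleftrightarrow> w = v - delta_psi r m v" for w
    using irreducible_representative_iff[of v r 0 w m] v 
    by (auto simp: aug_delta_def 0 term_vec_in_J_0_iff)
  then show ?thesis
    by (simp add: psi_delta_def aug_psi_def 0)
qed

theorem theorem5p2:
  fixes r q :: nat
    and m :: "nat \<Rightarrow> 'x::finite monomial"
    and prec0 :: "'x monomial \<Rightarrow> 'x monomial \<Rightarrow> bool"
  assumes distinct: "inj_on m {1..r}"
    and order: "is_term_order prec0"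
    and q: "q \<le> r"
  shows
    "(\<forall>v \<in> (Tay r q :: ('x, 'k::field) taylor set).
        is_normal_form (tless TYPE('k) m prec0 q) (Tay r q) (Delta r m q) v (psi_delta r m q v)) \<and>
     (\<forall>v \<in> (Tay r q :: ('x, 'k) taylor set). delta_psi r m v = v - psi_delta r m q v) \<and>
     (\<forall>v \<in> (Tay r q :: ('x, 'k) taylor set). delta_psi r m (delta_psi r m v) = delta_psi r m v) \<and>
     delta_psi r m ` (Tay r q :: ('x, 'k) taylor set) = J r m q"
proof (intro conjI ballI)
  fix v :: "('x, 'k) taylor" assume v: "v \<in> Tay r q"
  have "reduced_rep (tless TYPE('k) m prec0 q) (Tay r q) (Delta r m q) v w \<longleftrightarrow>
      w \<in> Tay r q \<and> v - w \<in> J r m q \<and> (\<forall>a\<in>terms w. \<not> reducible r m a)" for w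
    using term_vec_in_lt_module_iff[OF order, of _ r q m, where 'k = 'k]
    by (auto simp: reduced_rep_def span_Delta Tay_iff_terms)
  then show "is_normal_form (tless TYPE('k) m prec0 q) (Tay r q) (Delta r m q) v (psi_delta r m q v)"
    by (simp add: is_normal_form_def irreducible_representative_iff[OF v] psi_delta_eq[OF v])
  show "delta_psi r m v = v - psi_delta r m q v"
    by (simp add: psi_delta_eq[OF v])
  show "delta_psi r m (delta_psi r m v) = delta_psi r m v"
    using delta_psi_J[OF delta_psi_in_J[OF v]] .
next
  show "delta_psi r m ` (Tay r q :: ('x, 'k) taylor set) = J r m q"
  proof
    show "delta_psi r m ` Tay r q \<subseteq> (J r m q :: ('x, 'k) taylor set)"
      using delta_psi_in_J by blast
    show "(J r m q :: ('x, 'k) taylor set) \<subseteq> delta_psi r m ` Tay r q"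
    proof
      fix u :: "('x, 'k) taylor" assume "u \<in> J r m q"
      then show "u \<in> delta_psi r m ` Tay r q"
        using J_subset_Tay by (intro image_eqI[of _ _ u]) (auto simp: delta_psi_J)
    qed
  qed
qed
end
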